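(* Let $X$ be a real Banach space and let $A\subset X$ be a bounded subset. Let $\varepsilon_1$ be the infimum of the $\varepsilon>0$ for which there is $n_1\in\mathbb{N}$ such that for every $x^*\in B_{X^*}$ $$|\{x\in A: |x^*(x)|>\varepsilon\}|\le n_1,$$ and let $\varepsilon_2$ be the infimum of the $\varepsilon>0$ for which there is $n_2\in\mathbb{N}$ such that for any finite set $B\subset A$ with $|B|\ge n_2$ $$\left\|\frac{1}{|B|}\sum_{x\in B}x\right\|<\varepsilon.$$ Then $\varepsilon_1=\varepsilon_2$, and moreover $\Gamma(A)\le\varepsilon_1$.
   Context: $|S|$ denotes the cardinality of a set $S$, $B_X$ the closed unit ball of $X$; $\mathbb{N}=\{1,2,\dots\}$. Fix a free ultrafilter $\mathcal{U}$ on $\mathbb{N}$. $X^{\mathcal U}$ is the quotient of $\ell_\infty(X)$ by the subspace of those $(x_n)$ with $\lim_{n,\mathcal U}\|x_n\|=0$, so that the norm of the class of $(x_n)$ is $\lim_{n,\mathcal U}\|x_n\|$. For a bounded set $A\subset X$, $A^{\mathcal U}\subset X^{\mathcal U}$ is the set of elements having a representative in $A^{\mathbb N}$. For a bounded subset $A$ of a Banach space $Y$, $\gamma(A)=\inf\{\varepsilon>0:\overline{A}^{w^*}\subset Y+\varepsilon B_{Y^{**}}\}$, where the closure is the weak$^*$ closure in $Y^{**}$. For bounded $A\subset X$, $\Gamma(A):=\gamma(A^{\mathcal U})$, where $\gamma$ is computed in $X^{\mathcal U}$. *)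

theory Defs
  imports "HOL-Analysis.Analysis"
begin

definition free_ultrafilter :: "'i filter \<Rightarrow> bool"
  where "free_ultrafilter U \<longleftrightarrow>
    U \<noteq> bot \<and>
    (\<forall>P. eventually P U \<or> eventually (\<lambda>i. \<not> P i) U) \<and>
    (\<forall>i. eventually (\<lambda>j. j \<noteq> i) U)"


text \<open>
  An ultrapower depends on a term (the ultrafilter), so it is not a type.  Normed spaces are
  therefore given here by a carrier set together with their operations.
\<close>

record 'v nspace =
  vecs :: "'v set"
  vadd :: "'v \<Rightarrow> 'v \<Rightarrow> 'v"
  vscale :: "real \<Rightarrow> 'v \<Rightarrow> 'v"
  vnorm :: "'v \<Rightarrow> real"

definition unit_ball :: "'v nspace \<Rightarrow> 'v set"
  where "unit_ball Y = {y \<in> vecs Y. vnorm Y y \<le> 1}"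

text \<open>
  Functionals are made extensional (\<^const>\<open>undefined\<close> off the carrier), so that equality of
  functionals is equality on the carrier.
\<close>

definition dual :: "'v nspace \<Rightarrow> ('v \<Rightarrow> real) nspace"
  where "dual Y =
    \<lparr> vecs = {f \<in> extensional (vecs Y).
         (\<forall>x\<in>vecs Y. \<forall>y\<in>vecs Y. f (vadd Y x y) = f x + f y) \<and>
         (\<forall>r. \<forall>x\<in>vecs Y. f (vscale Y r x) = r * f x) \<and>
         (\<exists>K. \<forall>x\<in>vecs Y. \<bar>f x\<bar> \<le> K * vnorm Y x)},
      vadd = (\<lambda>f g. \<lambda>x\<in>vecs Y. f x + g x),
      vscale = (\<lambda>r f. \<lambda>x\<in>vecs Y. r * f x),
      vnorm = (\<lambda>f. SUP x\<in>unit_ball Y. \<bar>f x\<bar>) \<rparr>"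

definition canonical_embedding :: "'v nspace \<Rightarrow> 'v \<Rightarrow> ('v \<Rightarrow> real) \<Rightarrow> real"
  where "canonical_embedding Y y = (\<lambda>f\<in>vecs (dual Y). f y)"

definition weak_star_topology :: "'v nspace \<Rightarrow> ('v \<Rightarrow> real) topology"
  where "weak_star_topology Z =
    subtopology (product_topology (\<lambda>_. euclideanreal) (vecs Z)) (vecs (dual Z))"

definition gamma :: "'v nspace \<Rightarrow> 'v set \<Rightarrow> real"
  where "gamma Y A = Inf {\<epsilon>. \<epsilon> > 0 \<and>
    weak_star_topology (dual Y) closure_of (canonical_embedding Y ` A) \<subseteq>
      {vadd (dual (dual Y)) (canonical_embedding Y y) (vscale (dual (dual Y)) \<epsilon> b) | y b.
         y \<in> vecs Y \<and> b \<in> unit_ball (dual (dual Y))}}"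


definition coset :: "'v::real_normed_vector set \<Rightarrow> 'v \<Rightarrow> 'v set"
  where "coset N x = {x + m | m. m \<in> N}"

text \<open>
  The summand from \<open>N\<close> in the scalar multiplication is needed for \<open>r = 0\<close>, where
  \<open>r *\<^sub>R C\<close> is \<open>{0}\<close> rather than \<open>N\<close>.
\<close>

definition quotient_space :: "'v::real_normed_vector set \<Rightarrow> 'v set nspace"
  where "quotient_space N =
    \<lparr> vecs = range (coset N),
      vadd = (\<lambda>C D. {x + y | x y. x \<in> C \<and> y \<in> D}),
      vscale = (\<lambda>r C. {r *\<^sub>R x + m | x m. x \<in> C \<and> m \<in> N}),
      vnorm = (\<lambda>C. INF x\<in>C. norm x) \<rparr>"

text \<open>
  Every function on the discrete space \<^typ>\<open>nat\<close> is continuous, so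
  \<^typ>\<open>nat \<Rightarrow>\<^sub>C 'a\<close> with its supremum norm is the space of bounded sequences in \<^typ>\<open>'a\<close>.
\<close>

definition null_along :: "nat filter \<Rightarrow> (nat \<Rightarrow>\<^sub>C 'a::real_normed_vector) set"
  where "null_along U = {x. ((\<lambda>n. norm (apply_bcontfun x n)) \<longlongrightarrow> 0) U}"

definition ultrapower :: "nat filter \<Rightarrow> (nat \<Rightarrow>\<^sub>C 'a::real_normed_vector) set nspace"
  where "ultrapower U = quotient_space (null_along U)"

definition ultrapower_set ::
    "nat filter \<Rightarrow> 'a::real_normed_vector set \<Rightarrow> (nat \<Rightarrow>\<^sub>C 'a) set set"
  where "ultrapower_set U A =
    {C \<in> vecs (ultrapower U). \<exists>x\<in>C. \<forall>n. apply_bcontfun x n \<in> A}"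

definition ultra_gamma :: "nat filter \<Rightarrow> 'a::real_normed_vector set \<Rightarrow> real"
  where "ultra_gamma U A = gamma (ultrapower U) (ultrapower_set U A)"


lemma free_ultrafilter_bounded_tendsto:
  fixes f :: "'i \<Rightarrow> real"
  assumes U: "free_ultrafilter U" and f: "\<And>i. f i \<in> {a..b}"
  shows "\<exists>l. (f \<longlongrightarrow> l) U"
proof -
  have "filtermap f U \<noteq> bot"
    using U by (simp add: free_ultrafilter_def filtermap_bot_iff)
  moreover have "eventually (\<lambda>x. x \<in> {a..b}) (filtermap f U)"
    unfolding eventually_filtermap using f by (intro always_eventually) blast
  ultimately obtain l where l: "inf (nhds l) (filtermap f U) \<noteq> bot"
    using compact_Icc[of a b] unfolding compact_filter by (meson le_principal)
  have "(f \<longlongrightarrow> l) U"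
  proof (rule topological_tendstoI)
    fix S assume S: "open S" "l \<in> S"
    show "eventually (\<lambda>i. f i \<in> S) U"
    proof (rule ccontr)
      assume "\<not> ?thesis"
      then have "eventually (\<lambda>i. f i \<notin> S) U"
        using U unfolding free_ultrafilter_def by blast
      then have "eventually (\<lambda>x. x \<notin> S) (filtermap f U)"
        by (simp add: eventually_filtermap)
      moreover have "eventually (\<lambda>x. x \<in> S) (nhds l)"
        using S by (rule eventually_nhds_in_open)
      ultimately have "eventually (\<lambda>_. False) (inf (nhds l) (filtermap f U))"
        unfolding eventually_inf by blast
      with l show False by (simp add: trivial_limit_def)
    qed
  qed
  then show ?thesis ..
qed

text \<open>The quotient norm of the ultrapower is the limit of the norms along the ultrafilter.\<close>

lemma ultrapower_norm_tendsto:
  fixes x :: "nat \<Rightarrow>\<^sub>C 'a::real_normed_vector"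
  assumes U: "free_ultrafilter U"
  shows "((\<lambda>n. norm (apply_bcontfun x n)) \<longlongrightarrow> vnorm (ultrapower U) (coset (null_along U) x)) U"
proof -
  let ?C = "coset (null_along U) x"
  have nb: "U \<noteq> bot" using U by (simp add: free_ultrafilter_def)
  obtain l where l: "((\<lambda>n. norm (apply_bcontfun x n)) \<longlongrightarrow> l) U"
    using free_ultrafilter_bounded_tendsto[OF U, of "\<lambda>n. norm (apply_bcontfun x n)" 0 "norm x"]
    by (auto simp: norm_bounded)
  have l0: "0 \<le> l" using tendsto_lowerbound[OF l _ nb, of 0] by simp
  have low: "l \<le> norm y" if y: "y \<in> ?C" for y
  proof -
    obtain m where m: "y = x + m" "m \<in> null_along U" using y by (auto simp: coset_def)
    have "((\<lambda>n. norm (apply_bcontfun x n) - norm (apply_bcontfun m n)) \<longlongrightarrow> l - 0) U"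
      using m(2) by (intro tendsto_diff l) (simp add: null_along_def)
    moreover have "norm (apply_bcontfun x n) - norm (apply_bcontfun m n) \<le> norm y" for n
      using norm_bounded[of y n] norm_diff_ineq[of "apply_bcontfun x n" "apply_bcontfun m n"]
      by (simp add: m(1) plus_bcontfun.rep_eq)
    ultimately show ?thesis
      using tendsto_upperbound[OF _ _ nb] by (metis (no_types, lifting) diff_zero always_eventually)
  qed
  have ne: "?C \<noteq> {}"
    by (auto simp: coset_def null_along_def intro!: exI[of _ 0] simp: zero_bcontfun.rep_eq)
  have "(INF y\<in>?C. norm y) = l"
  proof (rule antisym)
    show "l \<le> (INF y\<in>?C. norm y)"
      using ne low by (intro cINF_greatest)
    show "(INF y\<in>?C. norm y) \<le> l"
    proof (rule field_le_epsilon)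
      fix e :: real assume e: "e > 0"
      define g where "g n = (if norm (apply_bcontfun x n) \<le> l + e then apply_bcontfun x n else 0)" for n
      have gle: "norm (g n) \<le> l + e" for n using l0 e by (simp add: g_def)
      then have "g \<in> bcontfun"
        unfolding bcontfun_def by (auto intro!: boundedI[of _ "l + e"])
      then have g: "apply_bcontfun (Bcontfun g) = g" by (simp add: Bcontfun_inverse)
      have "eventually (\<lambda>n. norm (apply_bcontfun x n) < l + e) U"
        using order_tendstoD(2)[OF l] e by simp
      then have "eventually (\<lambda>n. norm (apply_bcontfun (Bcontfun g - x) n) = 0) U"
        by eventually_elim (simp add: minus_bcontfun.rep_eq g g_def)
      then have "Bcontfun g - x \<in> null_along U"
        unfolding null_along_def by (simp add: tendsto_eventually)
      then have "Bcontfun g \<in> ?C"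
        unfolding coset_def by (auto intro!: exI[of _ "Bcontfun g - x"])
      then have "(INF y\<in>?C. norm y) \<le> norm (Bcontfun g)"
        by (intro cINF_lower) (auto intro: bdd_belowI[of _ 0])
      also have "\<dots> \<le> l + e"
        by (rule norm_bound) (simp add: g gle)
      finally show "(INF y\<in>?C. norm y) \<le> l + e" .
    qed
  qed
  with l show ?thesis by (simp add: ultrapower_def quotient_space_def)
qed

end

theory Submission
  imports Defs
begin

text \<open>
  The equality of the two constants comes from testing averages against functionals: averaging
  \<open>n\<close> vectors on which \<open>f\<close> exceeds \<open>\<epsilon>\<close> gives norm above \<open>\<epsilon>\<close>; conversely, a norming functional of
  an average is large on boundedly many of its terms only.  The condition on averages passes to
  the ultrapower, so each functional of norm at most \<open>1\<close> on \<open>X\<^sup>U\<close> exceeds \<open>\<epsilon>\<close> in absolute value at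
  finitely many points of \<open>A\<^sup>U\<close> only.  Hence every weak-star limit of \<open>A\<^sup>U\<close> is either a point of
  \<open>A\<^sup>U\<close> or has norm at most \<open>\<epsilon>\<close>.
\<close>

section \<open>Sublinear functionals and the Hahn-Banach theorem\<close>

definition sublinear :: "('a::real_vector \<Rightarrow> real) \<Rightarrow> bool"
  where "sublinear p \<longleftrightarrow>
    (\<forall>x y. p (x + y) \<le> p x + p y) \<and> (\<forall>c\<ge>0. \<forall>x. p (c *\<^sub>R x) = c * p x)"

lemma sublinear_add: "sublinear p \<Longrightarrow> p (x + y) \<le> p x + p y"
  and sublinear_scale: "sublinear p \<Longrightarrow> c \<ge> 0 \<Longrightarrow> p (c *\<^sub>R x) = c * p x"
  by (auto simp: sublinear_def)

lemma sublinear_zero: "sublinear p \<Longrightarrow> p 0 = 0"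
  using sublinear_scale[of p 0 0] by simp

lemma sublinear_ge_minus: "sublinear p \<Longrightarrow> - p (- x) \<le> p x"
  using sublinear_add[of p x "- x"] by (simp add: sublinear_zero)

text \<open>The inequality taken at \<open>1 / c\<close> and \<open>c *\<^sub>R x\<close> is the
  reverse of the one at \<open>c\<close> and \<open>x\<close>, so the two force equality.\<close>

lemma sublinearI:
  assumes "\<And>x y. p (x + y) \<le> p x + p y" "p 0 = 0" and le: "\<And>c x. c > 0 \<Longrightarrow> p (c *\<^sub>R x) \<le> c * p x"
  shows "sublinear p"
proof -
  have "p (c *\<^sub>R x) = c * p x" if "c \<ge> 0" for c x
  proof (cases "c = 0")
    case False
    with that have c: "c > 0" by simp
    have "p x \<le> (1 / c) * p (c *\<^sub>R x)" using le[of "1 / c" "c *\<^sub>R x"] c by simp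
    then show ?thesis using le[OF c, of x] c by (simp add: field_simps)
  qed (simp add: assms)
  with assms show ?thesis by (simp add: sublinear_def)
qed

text \<open>For sublinear \<open>p\<close> this is the one-sided directional derivative of
  \<open>p\<close> at \<open>v\<close> towards \<open>x\<close>: for t > 0 and h = 1/t the
  expression is (p (v + h x) - p v) / h, which decreases to its limit as h tends to 0. Admitting t =
  0 makes the slope lie below \<open>p\<close>.\<close>

definition slope :: "('a::real_vector \<Rightarrow> real) \<Rightarrow> 'a \<Rightarrow> 'a \<Rightarrow> real"
  where "slope p v x = (INF t\<in>{0..}. p (x + t *\<^sub>R v) - t * p v)"

lemma slope_le:
  assumes p: "sublinear p" and t: "t \<ge> 0"
  shows "slope p v x \<le> p (x + t *\<^sub>R v) - t * p v"
  unfolding slope_def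
proof (rule cINF_lower)
  \<comment> \<open>The infimum is informative only over a set bounded below. Writing
    \<open>s *\<^sub>R v\<close> as the sum of \<open>x + s *\<^sub>R v\<close> and
    \<open>- x\<close> gives a bound independent of \<open>s\<close>.\<close>
  have "- p (- x) \<le> p (x + s *\<^sub>R v) - s * p v" if "s \<ge> 0" for s
    using sublinear_add[OF p, of "x + s *\<^sub>R v" "- x"] sublinear_scale[OF p that, of v] by simp
  then show "bdd_below ((\<lambda>t. p (x + t *\<^sub>R v) - t * p v) ` {0..})"
    by (intro bdd_belowI2[of _ "- p (- x)"]) simp
qed (use t in simp)

lemma slope_greatest:
  assumes "\<And>t. t \<ge> 0 \<Longrightarrow> b \<le> p (x + t *\<^sub>R v) - t * p v"
  shows "b \<le> slope p v x"
  unfolding slope_def using assms by (intro cINF_greatest) auto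

lemma sublinear_slope:
  assumes p: "sublinear p"
  shows "sublinear (slope p v)"
proof (rule sublinearI)
  fix x y
  \<comment> \<open>The parameters \<open>s\<close> for \<open>x\<close> and \<open>t\<close> for
    \<open>y\<close> merge into \<open>s + t\<close> for \<open>x + y\<close>; the infimum is then
    taken over \<open>t\<close> with \<open>s\<close> fixed, and afterwards over
    \<open>s\<close>.\<close>
  have "slope p v (x + y) - (p (x + s *\<^sub>R v) - s * p v) \<le> slope p v y" if s: "s \<ge> 0" for s
  proof (rule slope_greatest)
    fix t :: real assume t: "t \<ge> 0"
    have "slope p v (x + y) \<le> p (x + y + (s + t) *\<^sub>R v) - (s + t) * p v"
      using s t by (intro slope_le p) simp
    also have "x + y + (s + t) *\<^sub>R v = (x + s *\<^sub>R v) + (y + t *\<^sub>R v)"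
      by (simp add: algebra_simps)
    also have "p \<dots> \<le> p (x + s *\<^sub>R v) + p (y + t *\<^sub>R v)" by (rule sublinear_add[OF p])
    finally show "slope p v (x + y) - (p (x + s *\<^sub>R v) - s * p v) \<le> p (y + t *\<^sub>R v) - t * p v"
      by (simp add: algebra_simps)
  qed
  then have "slope p v (x + y) - slope p v y \<le> slope p v x"
    by (intro slope_greatest) (simp add: algebra_simps)
  then show "slope p v (x + y) \<le> slope p v x + slope p v y" by simp
next
  show "slope p v 0 = 0"
    using slope_le[OF p, of 0 v 0]
    by (intro antisym slope_greatest) (auto simp: sublinear_scale[OF p] sublinear_zero[OF p])
next
  fix c :: real and x assume c: "c > 0"
  have "slope p v (c *\<^sub>R x) / c \<le> slope p v x"
  proof (rule slope_greatest)
    fix t :: real assume t: "t \<ge> 0"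
    \<comment> \<open>The parameter \<open>c * t\<close> at \<open>c *\<^sub>R x\<close> corresponds
      to \<open>t\<close> at \<open>x\<close>.\<close>
    have "slope p v (c *\<^sub>R x) \<le> p (c *\<^sub>R x + (c * t) *\<^sub>R v) - c * t * p v"
      using c t by (intro slope_le p) simp
    also have "c *\<^sub>R x + (c * t) *\<^sub>R v = c *\<^sub>R (x + t *\<^sub>R v)" by (simp add: algebra_simps)
    also have "p \<dots> = c * p (x + t *\<^sub>R v)" using c by (intro sublinear_scale[OF p]) simp
    finally show "slope p v (c *\<^sub>R x) / c \<le> p (x + t *\<^sub>R v) - t * p v"
      using c by (simp add: field_simps)
  qed
  then show "slope p v (c *\<^sub>R x) \<le> c * slope p v x" using c by (simp add: field_simps)
qed

text \<open>The pointwise infimum works. Infima do not preserve subadditivity in general, but in a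
  chain two members can both be replaced by the smaller one.\<close>

lemma sublinear_chain_lower_bound:
  assumes ne: "C \<noteq> {}" and C: "\<And>q. q \<in> C \<Longrightarrow> sublinear q \<and> q \<le> p"
    and chain: "\<And>q r. q \<in> C \<Longrightarrow> r \<in> C \<Longrightarrow> q \<le> r \<or> r \<le> q"
  shows "\<exists>u. sublinear u \<and> u \<le> p \<and> (\<forall>q\<in>C. u \<le> q)"
proof -
  define u where "u x = (INF q\<in>C. q x)" for x
  have low: "u x \<le> q x" if "q \<in> C" for q x
    unfolding u_def
  proof (rule cINF_lower[OF _ that])
    \<comment> \<open>Since \<open>q\<close> lies below \<open>p\<close>,
      \<open>- p (- x) \<le> - q (- x) \<le> q x\<close>, a bound common to the whole chain.\<close>
    have "- p (- x) \<le> q x" if "q \<in> C" for q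
      using sublinear_ge_minus[of q x] C[OF that] by (smt (verit) le_funD)
    then show "bdd_below ((\<lambda>q. q x) ` C)" by (intro bdd_belowI2[of _ "- p (- x)"])
  qed
  have great: "b \<le> u x" if "\<And>q. q \<in> C \<Longrightarrow> b \<le> q x" for b x
    unfolding u_def using ne that by (intro cINF_greatest) auto
  have "sublinear u"
  proof (rule sublinearI)
    fix x y
    have le: "u (x + y) \<le> q x + r y" if qr: "q \<in> C" "r \<in> C" for q r
    proof -
      obtain m where m: "m \<in> C" "m \<le> q" "m \<le> r" using chain[OF qr] qr by blast
      have "u (x + y) \<le> m x + m y"
        using low[OF m(1), of "x + y"] sublinear_add[of m x y] C[OF m(1)] by simp
      also have "\<dots> \<le> q x + r y" using m by (intro add_mono) (auto simp: le_fun_def)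
      finally show ?thesis .
    qed
    have "u (x + y) - q x \<le> u y" if "q \<in> C" for q
      by (intro great) (drule le[OF that], linarith)
    then have "u (x + y) - u y \<le> u x"
      by (intro great) (simp add: algebra_simps)
    then show "u (x + y) \<le> u x + u y" by simp
  next
    show "u 0 = 0" using ne C by (auto simp: u_def sublinear_zero)
  next
    fix c :: real and x assume c: "c > 0"
    have "u (c *\<^sub>R x) / c \<le> u x"
    proof (rule great)
      fix q assume q: "q \<in> C"
      have "u (c *\<^sub>R x) \<le> c * q x"
        using low[OF q, of "c *\<^sub>R x"] C[OF q] c sublinear_scale[of q c x] by simp
      then show "u (c *\<^sub>R x) / c \<le> q x" using c by (simp add: field_simps)
    qed
    then show "u (c *\<^sub>R x) \<le> c * u x" using c by (simp add: field_simps)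
  qed
  moreover have "u \<le> p"
  proof -
    obtain q where q: "q \<in> C" using ne by blast
    then have "u \<le> q" by (auto simp: le_fun_def low)
    also have "q \<le> p" using C[OF q] by blast
    finally show ?thesis .
  qed
  ultimately show ?thesis using low by (auto simp: le_fun_def)
qed

text \<open>
  Hahn--Banach: a minimal sublinear functional below \<^term>\<open>p\<close> equals all of its slopes and is
  therefore additive.
\<close>

lemma linear_below_sublinear:
  fixes p :: "'a::real_vector \<Rightarrow> real"
  assumes p: "sublinear p"
  shows "\<exists>f. linear f \<and> f \<le> p"
proof -
  let ?S = "{q. sublinear q \<and> q \<le> p}"
  \<comment> \<open>Zorn's lemma in the reversed order: bounds of chains are lower bounds and the
    maximal element is a minimal functional. The empty chain is bounded by \<open>p\<close>
    itself.\<close>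
  have "\<exists>m\<in>?S. \<forall>q\<in>?S. m \<ge> q \<longrightarrow> q = m"
  proof (rule predicate_Zorn)
    show "partial_order_on ?S (relation_of (\<ge>) ?S)"
      by (rule partial_order_on_relation_ofI) auto
    fix C assume C: "C \<in> Chains (relation_of (\<ge>) ?S)"
    show "\<exists>u\<in>?S. \<forall>q\<in>C. u \<le> q"
    proof (cases "C = {}")
      case False
      with C show ?thesis
        using sublinear_chain_lower_bound[of C p]
        unfolding Chains_def relation_of_def by blast
    qed (use p in auto)
  qed
  then obtain f where f: "sublinear f" "f \<le> p"
    and min: "\<And>q. sublinear q \<Longrightarrow> q \<le> f \<Longrightarrow> q = f"
    by (auto intro: order_trans)
  have "slope f v = f" for v
    using slope_le[OF f(1), of 0 v] by (intro min sublinear_slope f) (simp add: le_fun_def)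
  \<comment> \<open>The parameter 1 in the infimum turns the equality with the slope into
    superadditivity.\<close>
  then have "f x \<le> f (x + v) - f v" for x v
    using slope_le[OF f(1), of 1 v x] by simp
  then have add: "f (x + y) = f x + f y" for x y
    using sublinear_add[OF f(1), of x y] by (smt (verit))
  have neg: "f (- x) = - f x" for x
    using add[of x "- x"] sublinear_zero[OF f(1)] by simp
  have "f (c *\<^sub>R x) = c *\<^sub>R f x" for c x
  proof (cases "c \<ge> 0")
    case False
    then show ?thesis using sublinear_scale[OF f(1), of "- c" x] neg[of "c *\<^sub>R x"] by simp
  qed (simp add: sublinear_scale[OF f(1)])
  with add have "linear f" by (intro linearI)
  with f show ?thesis by blast
qed

text \<open>Applying Hahn-Banach to \<open>slope norm v\<close> replaces extending a functional from
  the line through \<open>v\<close>: parameter 0 gives \<open>f \<le> norm\<close>, and parameter 1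
  at \<open>- v\<close> gives \<open>f (- v) \<le> - norm v\<close>, so that \<open>f\<close>
  attains the norm at \<open>v\<close>.\<close>

lemma norming_functional:
  fixes v :: "'a::real_normed_vector"
  shows "\<exists>f :: 'a \<Rightarrow>\<^sub>L real. norm f \<le> 1 \<and> blinfun_apply f v = norm v"
proof -
  have n: "sublinear (norm :: 'a \<Rightarrow> real)"
    by (simp add: sublinear_def norm_triangle_ineq)
  obtain f where f: "linear f" "f \<le> slope norm v"
    using linear_below_sublinear[OF sublinear_slope[OF n]] by blast
  have le: "f x \<le> norm x" for x
    using le_funD[OF f(2), of x] slope_le[OF n, of 0 v x] by simp
  have abs: "\<bar>f x\<bar> \<le> norm x" for x
    using le[of x] le[of "- x"] by (simp add: linear_neg[OF f(1)])
  have "f (- v) \<le> - norm v"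
    using le_funD[OF f(2), of "- v"] slope_le[OF n, of 1 v "- v"] by simp
  then have "f v = norm v" using le[of v] by (simp add: linear_neg[OF f(1)])
  moreover have bl: "bounded_linear f"
    using f(1) abs by (auto simp: bounded_linear_def bounded_linear_axioms_def intro!: exI[of _ 1])
  moreover have "norm (Blinfun f) \<le> 1"
    using abs by (intro norm_blinfun_bound) (auto simp: bounded_linear_Blinfun_apply[OF bl])
  ultimately show ?thesis by (intro exI[of _ "Blinfun f"]) (simp add: bounded_linear_Blinfun_apply)
qed

section \<open>Duals of spaces given by carriers, and an upper bound for
  \<open>gamma\<close>\<close>

lemma dual_simps:
  "vecs (dual Y) = {f \<in> extensional (vecs Y).
     (\<forall>x\<in>vecs Y. \<forall>y\<in>vecs Y. f (vadd Y x y) = f x + f y) \<and>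
     (\<forall>r. \<forall>x\<in>vecs Y. f (vscale Y r x) = r * f x) \<and>
     (\<exists>K. \<forall>x\<in>vecs Y. \<bar>f x\<bar> \<le> K * vnorm Y x)}"
  "vadd (dual Y) f g = (\<lambda>x\<in>vecs Y. f x + g x)"
  "vscale (dual Y) r f = (\<lambda>x\<in>vecs Y. r * f x)"
  "vnorm (dual Y) f = (SUP x\<in>unit_ball Y. \<bar>f x\<bar>)"
  by (simp_all add: dual_def)

definition closed_operations :: "'v nspace \<Rightarrow> bool"
  where "closed_operations Y \<longleftrightarrow>
    (\<forall>x\<in>vecs Y. \<forall>y\<in>vecs Y. vadd Y x y \<in> vecs Y) \<and> (\<forall>r. \<forall>x\<in>vecs Y. vscale Y r x \<in> vecs Y)"

text \<open>Closure keeps sums and multiples inside the carrier, where restriction leaves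
  \<open>f\<close> unchanged; at a point outside, the value \<open>undefined\<close> could destroy
  linearity.\<close>

lemma restrict_in_dual:
  assumes "closed_operations Y"
    and "\<And>x y. x \<in> vecs Y \<Longrightarrow> y \<in> vecs Y \<Longrightarrow> f (vadd Y x y) = f x + f y"
    and "\<And>r x. x \<in> vecs Y \<Longrightarrow> f (vscale Y r x) = r * f x"
    and "\<And>x. x \<in> vecs Y \<Longrightarrow> \<bar>f x\<bar> \<le> K * vnorm Y x"
  shows "restrict f (vecs Y) \<in> vecs (dual Y)"
  using assms by (auto simp: dual_simps(1) closed_operations_def intro!: exI[of _ K])

lemma closed_operations_dual:
  assumes Y: "closed_operations Y"
  shows "closed_operations (dual Y)"
proof -
  have "vadd (dual Y) f g \<in> vecs (dual Y)" if f: "f \<in> vecs (dual Y)" and g: "g \<in> vecs (dual Y)" for f g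
  proof -
    obtain K L where "\<forall>x\<in>vecs Y. \<bar>f x\<bar> \<le> K * vnorm Y x" "\<forall>x\<in>vecs Y. \<bar>g x\<bar> \<le> L * vnorm Y x"
      using f g by (auto simp: dual_simps(1))
    then have "\<bar>f x + g x\<bar> \<le> (K + L) * vnorm Y x" if "x \<in> vecs Y" for x
      using that by (smt (verit) distrib_right)
    with f g show ?thesis
      unfolding dual_simps(2)
      by (intro restrict_in_dual[OF Y, where K = "K + L"]) (auto simp: dual_simps(1) algebra_simps)
  qed
  moreover have "vscale (dual Y) r f \<in> vecs (dual Y)" if f: "f \<in> vecs (dual Y)" for r f
  proof -
    obtain K where "\<forall>x\<in>vecs Y. \<bar>f x\<bar> \<le> K * vnorm Y x"
      using f by (auto simp: dual_simps(1))
    then have "\<bar>r * f x\<bar> \<le> (\<bar>r\<bar> * K) * vnorm Y x" if "x \<in> vecs Y" for x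
      using that by (simp add: abs_mult mult.assoc mult_left_mono)
    with f show ?thesis
      unfolding dual_simps(3)
      by (intro restrict_in_dual[OF Y, where K = "\<bar>r\<bar> * K"]) (auto simp: dual_simps(1) algebra_simps)
  qed
  ultimately show ?thesis by (simp add: closed_operations_def)
qed

lemma zero_in_unit_ball_dual:
  assumes "closed_operations Y" "unit_ball Y \<noteq> {}"
  shows "(\<lambda>x\<in>vecs Y. 0) \<in> unit_ball (dual Y)"
proof -
  have "(SUP x\<in>unit_ball Y. \<bar>(\<lambda>x\<in>vecs Y. 0::real) x\<bar>) \<le> 1"
    using assms by (intro cSUP_least) (auto simp: unit_ball_def)
  moreover have "(\<lambda>x\<in>vecs Y. 0) \<in> vecs (dual Y)"
    using assms(1) by (intro restrict_in_dual[where K = 0]) auto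
  ultimately show ?thesis by (simp add: unit_ball_def dual_simps(4))
qed

text \<open>The image of \<open>A\<close> is covered by two closed sets: the finitely many image
  points with large value at \<open>f\<close>, closed because the topology is Hausdorff, and the set
  where evaluation at \<open>f\<close> lies in \<open>{-e..e}\<close>. A limit outside the image
  must lie in the second.\<close>

lemma weak_star_limit_bound:
  assumes f: "f \<in> vecs Z" and fin: "finite {y \<in> A. \<bar>i y f\<bar> > e}"
    and z: "z \<in> weak_star_topology Z closure_of (i ` A)" "z \<notin> i ` A"
  shows "\<bar>z f\<bar> \<le> e"
proof -
  let ?T = "weak_star_topology Z"
  let ?F = "{y \<in> A. \<bar>i y f\<bar> > e}"
  let ?S = "{w \<in> topspace ?T. w f \<in> {-e..e}}"
  have "Hausdorff_space ?T"
    unfolding weak_star_topology_def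
    by (intro Hausdorff_space_subtopology) (simp add: Hausdorff_space_product_topology)
  \<comment> \<open>The map \<open>i\<close> is not assumed to take values in the topological space,
    hence the intersection with \<open>topspace ?T\<close>; the closure ignores points outside
    it.\<close>
  then have "closedin ?T (topspace ?T \<inter> i ` ?F)"
    using fin by (meson Hausdorff_imp_t1_space t1_space_closedin_finite finite_Int finite_imageI inf_le1)
  moreover have "closedin ?T ?S"
  proof (rule closedin_continuous_map_preimage)
    show "continuous_map ?T euclideanreal (\<lambda>w. w f)"
      using f unfolding weak_star_topology_def
      by (intro continuous_map_from_subtopology continuous_map_product_projection)
  qed simp
  ultimately have "?T closure_of (i ` A) \<subseteq> (topspace ?T \<inter> i ` ?F) \<union> ?S"
    unfolding closure_of_restrict[of _ "i ` A"]
    by (intro closure_of_minimal closedin_Un) auto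
  with z show ?thesis by auto
qed

text \<open>A weak-star limit that is the image of a point of \<open>A\<close> is that image plus
  \<open>e\<close> times the zero functional. Any other limit \<open>z\<close> is bounded by
  \<open>e\<close> on the dual ball, so it is the image of zero plus \<open>e\<close> times
  \<open>z / e\<close>. The record has no zero field, and \<open>y0\<close> stands for the zero
  vector.\<close>

lemma gamma_le:
  assumes e: "e > 0" and Y: "closed_operations Y"
    and y0: "y0 \<in> vecs Y" "vscale Y 0 y0 = y0" "vnorm Y y0 = 0"
    and A: "A \<subseteq> vecs Y"
    and fin: "\<And>f. f \<in> unit_ball (dual Y) \<Longrightarrow> finite {y \<in> A. \<bar>f y\<bar> > e}"
  shows "gamma Y A \<le> e"
proof -
  let ?Z = "dual (dual Y)"
  let ?i = "canonical_embedding Y"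
  have bY: "unit_ball Y \<noteq> {}" using y0 by (auto simp: unit_ball_def)
  have bD: "unit_ball (dual Y) \<noteq> {}" using zero_in_unit_ball_dual[OF Y bY] by blast
  have zz: "(\<lambda>f\<in>vecs (dual Y). 0) \<in> unit_ball ?Z"
    by (rule zero_in_unit_ball_dual[OF closed_operations_dual[OF Y] bD])
  have "z \<in> {vadd ?Z (?i y) (vscale ?Z e b) | y b. y \<in> vecs Y \<and> b \<in> unit_ball ?Z}"
    if z: "z \<in> weak_star_topology (dual Y) closure_of (?i ` A)" for z
  proof (cases "z \<in> ?i ` A")
    case True
    then obtain y where y: "y \<in> A" "z = ?i y" by blast
    have "z = vadd ?Z (?i y) (vscale ?Z e (\<lambda>f\<in>vecs (dual Y). 0))"
      unfolding y(2) dual_simps(2,3)[of "dual Y"] by (auto simp: canonical_embedding_def)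
    with y A zz show ?thesis by blast
  next
    case False
    have bound: "\<bar>z f\<bar> \<le> e" if f: "f \<in> unit_ball (dual Y)" for f
    proof (rule weak_star_limit_bound[OF _ _ z False])
      show fv: "f \<in> vecs (dual Y)" using f by (simp add: unit_ball_def)
      show "finite {y \<in> A. \<bar>?i y f\<bar> > e}"
        using fin[OF f] fv by (simp add: canonical_embedding_def)
    qed
    have zv: "z \<in> vecs ?Z"
      using z closure_of_subset_topspace[of "weak_star_topology (dual Y)"]
      by (auto simp: weak_star_topology_def)
    define b where "b = (\<lambda>f\<in>vecs (dual Y). z f / e)"
    \<comment> \<open>Homogeneity at \<open>vscale Y 0 y0 = y0\<close> gives
      \<open>f y0 = 0 * f y0\<close>, so \<open>y0\<close> embeds as the zero functional.\<close>
    have zo: "f y0 = 0" if "f \<in> vecs (dual Y)" for f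
      using that y0 by (auto simp: dual_def)
    obtain K where K: "\<forall>f\<in>vecs (dual Y). \<bar>z f\<bar> \<le> K * vnorm (dual Y) f"
      using zv by (auto simp: dual_simps(1)[of "dual Y"])
    have "b \<in> vecs ?Z"
      unfolding b_def
    proof (rule restrict_in_dual[OF closed_operations_dual[OF Y], where K = "K / e"])
      fix f assume "f \<in> vecs (dual Y)"
      with K e show "\<bar>z f / e\<bar> \<le> K / e * vnorm (dual Y) f"
        by (simp add: divide_right_mono)
    qed (use zv in \<open>auto simp: dual_simps(1)[of "dual Y"] add_divide_distrib\<close>)
    moreover have "(SUP f\<in>unit_ball (dual Y). \<bar>b f\<bar>) \<le> 1"
      using bD bound e by (intro cSUP_least) (auto simp: b_def unit_ball_def)
    ultimately have "b \<in> unit_ball ?Z" by (simp add: unit_ball_def dual_simps(4))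
    moreover have "z = vadd ?Z (?i y0) (vscale ?Z e b)"
    proof -
      have "z \<in> extensional (vecs (dual Y))" using zv by (simp add: dual_simps(1)[of "dual Y"])
      then show ?thesis
        unfolding dual_simps(2,3)[of "dual Y"] using e zo
        by (auto simp: b_def canonical_embedding_def extensional_def)
    qed
    ultimately show ?thesis using y0 by blast
  qed
  then show ?thesis
    unfolding gamma_def using e by (intro cInf_lower bdd_belowI[of _ 0]) auto
qed

section \<open>Quotient operations and functionals on the ultrapower\<close>

lemma coset_eqI:
  assumes N: "subspace N" and "x - y \<in> N"
  shows "coset N x = coset N y"
proof -
  have *: "coset N x \<subseteq> coset N y" if d: "x - y \<in> N" for x y
  proof -
    have "x + m = y + (x - y + m)" "x - y + m \<in> N" if "m \<in> N" for m
      using subspace_add[OF N d that] by auto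
    then show ?thesis unfolding coset_def by blast
  qed
  show ?thesis
    using *[OF assms(2)] *[of y x] subspace_neg[OF N assms(2)] by simp
qed

lemma self_in_coset: "subspace N \<Longrightarrow> x \<in> coset N x"
  using subspace_0[of N] by (force simp: coset_def)

lemma coset_eq_of_mem:
  assumes "subspace N" "y \<in> coset N x"
  shows "coset N y = coset N x"
  using assms by (intro coset_eqI) (auto simp: coset_def)

lemma vadd_quotient_space:
  assumes N: "subspace N"
  shows "vadd (quotient_space N) (coset N x) (coset N y) = coset N (x + y)"
proof (intro equalityI subsetI)
  fix z assume "z \<in> vadd (quotient_space N) (coset N x) (coset N y)"
  then obtain m m' where m: "z = (x + m) + (y + m')" "m \<in> N" "m' \<in> N"
    by (auto simp: quotient_space_def coset_def)
  then have "z = (x + y) + (m + m')" "m + m' \<in> N"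
    by (auto simp: algebra_simps subspace_add[OF N])
  then show "z \<in> coset N (x + y)" by (auto simp: coset_def)
next
  fix z assume "z \<in> coset N (x + y)"
  then obtain m where m: "z = x + (y + m)" "m \<in> N" by (auto simp: coset_def algebra_simps)
  then have "y + m \<in> coset N y" by (auto simp: coset_def)
  with m self_in_coset[OF N, of x] show "z \<in> vadd (quotient_space N) (coset N x) (coset N y)"
    by (auto simp: quotient_space_def)
qed

lemma vscale_quotient_space:
  assumes N: "subspace N"
  shows "vscale (quotient_space N) r (coset N x) = coset N (r *\<^sub>R x)"
proof (intro equalityI subsetI)
  fix z assume "z \<in> vscale (quotient_space N) r (coset N x)"
  then obtain m m' where m: "z = r *\<^sub>R (x + m) + m'" "m \<in> N" "m' \<in> N"
    by (auto simp: quotient_space_def coset_def)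
  then have "z = r *\<^sub>R x + (r *\<^sub>R m + m')" "r *\<^sub>R m + m' \<in> N"
    by (auto simp: algebra_simps subspace_add[OF N] subspace_scale[OF N])
  then show "z \<in> coset N (r *\<^sub>R x)" by (auto simp: coset_def)
next
  fix z assume "z \<in> coset N (r *\<^sub>R x)"
  then obtain m where m: "z = r *\<^sub>R x + m" "m \<in> N" by (auto simp: coset_def)
  with self_in_coset[OF N, of x] show "z \<in> vscale (quotient_space N) r (coset N x)"
    by (auto simp: quotient_space_def)
qed

lemma null_along_iff: "x \<in> null_along U \<longleftrightarrow> (apply_bcontfun x \<longlongrightarrow> 0) U"
  by (simp add: null_along_def tendsto_norm_zero_iff)

lemma subspace_null_along: "subspace (null_along U)"
proof (rule subspaceI)
  show "0 \<in> null_along U" by (simp add: null_along_def)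
next
  fix x y :: "nat \<Rightarrow>\<^sub>C 'a" assume "x \<in> null_along U" "y \<in> null_along U"
  then have "((\<lambda>n. apply_bcontfun x n + apply_bcontfun y n) \<longlongrightarrow> 0) U"
    by (intro tendsto_add_zero) (simp_all add: null_along_iff)
  then show "x + y \<in> null_along U" by (simp add: null_along_iff plus_bcontfun.rep_eq)
next
  fix c and x :: "nat \<Rightarrow>\<^sub>C 'a" assume "x \<in> null_along U"
  then have "((\<lambda>n. c *\<^sub>R apply_bcontfun x n) \<longlongrightarrow> c *\<^sub>R 0) U"
    by (intro tendsto_scaleR tendsto_const) (simp add: null_along_iff)
  then show "c *\<^sub>R x \<in> null_along U" by (simp add: null_along_iff scaleR_bcontfun.rep_eq)
qed

lemmas ultrapower_ops =
  vadd_quotient_space[OF subspace_null_along, folded ultrapower_def]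
  vscale_quotient_space[OF subspace_null_along, folded ultrapower_def]

lemma vecs_ultrapower: "vecs (ultrapower U) = range (coset (null_along U))"
  by (simp add: ultrapower_def quotient_space_def)

lemma closed_operations_ultrapower: "closed_operations (ultrapower U)"
  by (auto simp: closed_operations_def vecs_ultrapower ultrapower_ops)

text \<open>Both sides are limits along \<open>U\<close> of the same real sequence.\<close>

lemma ultrapower_norm_scale:
  assumes U: "free_ultrafilter U"
  shows "vnorm (ultrapower U) (coset (null_along U) (c *\<^sub>R x)) =
    \<bar>c\<bar> * vnorm (ultrapower U) (coset (null_along U) x)"
proof (rule tendsto_unique)
  show "U \<noteq> bot" using U by (simp add: free_ultrafilter_def)
  show "((\<lambda>n. \<bar>c\<bar> * norm (apply_bcontfun x n)) \<longlongrightarrow>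
      vnorm (ultrapower U) (coset (null_along U) (c *\<^sub>R x))) U"
    using ultrapower_norm_tendsto[OF U, of "c *\<^sub>R x"] by (simp add: scaleR_bcontfun.rep_eq)
qed (intro tendsto_intros ultrapower_norm_tendsto U)

lemma ultrapower_norm_nonneg:
  assumes U: "free_ultrafilter U"
  shows "0 \<le> vnorm (ultrapower U) (coset (null_along U) x)"
  using U by (intro tendsto_lowerbound[OF ultrapower_norm_tendsto[OF U]]) (auto simp: free_ultrafilter_def)

text \<open>The dual norm controls \<open>f\<close> on the unit ball only; rescaling a vector into
  the ball turns this into a bound by the norm everywhere.\<close>

lemma unit_ball_dual_ultrapower:
  assumes U: "free_ultrafilter U" and f: "f \<in> unit_ball (dual (ultrapower U))"
  shows "linear (\<lambda>x. f (coset (null_along U) x))"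
    and "\<bar>f (coset (null_along U) x)\<bar> \<le> vnorm (ultrapower U) (coset (null_along U) x)"
proof -
  let ?c = "coset (null_along U)" and ?Y = "ultrapower U"
  have f': "f \<in> vecs (dual ?Y)" "(SUP y\<in>unit_ball ?Y. \<bar>f y\<bar>) \<le> 1"
    using f by (auto simp: unit_ball_def dual_simps(4))
  then obtain K where K: "\<forall>y\<in>vecs ?Y. \<bar>f y\<bar> \<le> K * vnorm ?Y y"
    by (auto simp: dual_simps(1))
  show lin: "linear (\<lambda>x. f (?c x))"
    using f'(1) by (intro linearI) (auto simp: dual_simps(1) vecs_ultrapower simp flip: ultrapower_ops)
  have one: "\<bar>f (?c w)\<bar> \<le> 1" if w: "vnorm ?Y (?c w) \<le> 1" for w
  proof -
    \<comment> \<open>A supremum dominates its terms only if they are bounded above, which the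
      continuity constant ensures. It may be negative, hence the absolute value.\<close>
    have "\<bar>f y\<bar> \<le> \<bar>K\<bar>" if y: "y \<in> unit_ball ?Y" for y
    proof -
      obtain v where v: "y = ?c v" using y by (auto simp: unit_ball_def vecs_ultrapower)
      have "K * vnorm ?Y y \<le> \<bar>K\<bar> * vnorm ?Y y"
        unfolding v by (intro mult_right_mono ultrapower_norm_nonneg[OF U]) simp
      also have "\<dots> \<le> \<bar>K\<bar> * 1"
        using y by (intro mult_left_mono) (auto simp: unit_ball_def)
      finally show ?thesis using K y by (force simp: unit_ball_def)
    qed
    then have "bdd_above ((\<lambda>y. \<bar>f y\<bar>) ` unit_ball ?Y)" by (intro bdd_aboveI2)
    moreover have "?c w \<in> unit_ball ?Y" using w by (auto simp: unit_ball_def vecs_ultrapower)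
    ultimately have "\<bar>f (?c w)\<bar> \<le> (SUP y\<in>unit_ball ?Y. \<bar>f y\<bar>)" by (intro cSUP_upper)
    with f'(2) show ?thesis by simp
  qed
  show "\<bar>f (?c x)\<bar> \<le> vnorm ?Y (?c x)"
  proof (rule field_le_epsilon)
    fix d :: real assume d: "d > 0"
    \<comment> \<open>The summand \<open>d\<close> keeps the divisor positive even for a class of
      norm 0; it vanishes in the limit.\<close>
    define s where "s = vnorm ?Y (?c x) + d"
    have s: "s > 0" using d ultrapower_norm_nonneg[OF U, of x] by (simp add: s_def)
    have "vnorm ?Y (?c ((1 / s) *\<^sub>R x)) \<le> 1"
      using s d unfolding ultrapower_norm_scale[OF U] by (simp add: s_def)
    then have "\<bar>f (?c ((1 / s) *\<^sub>R x))\<bar> \<le> 1" by (rule one)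
    moreover have "f (?c ((1 / s) *\<^sub>R x)) = f (?c x) / s"
      using linear_scale[OF lin] by simp
    ultimately show "\<bar>f (?c x)\<bar> \<le> vnorm ?Y (?c x) + d"
      using s by (simp add: s_def abs_divide)
  qed
qed

section \<open>Averages in the ultrapower and the bound on \<open>ultra_gamma\<close>\<close>

lemma ultrapower_setE:
  assumes "C \<in> ultrapower_set U A"
  obtains x where "C = coset (null_along U) x" "\<And>n. apply_bcontfun x n \<in> A"
  using assms coset_eq_of_mem[OF subspace_null_along]
  unfolding ultrapower_set_def vecs_ultrapower by blast

text \<open>
  Representatives of distinct classes differ on a set of indices belonging to the ultrafilter, so
  averages in the ultrapower of \<^term>\<open>A\<close> are represented by averages over sets of the same
  cardinality in \<^term>\<open>A\<close>.
\<close>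

lemma ultrapower_average_le:
  assumes U: "free_ultrafilter U"
    and avg: "\<And>B. finite B \<Longrightarrow> B \<subseteq> A \<Longrightarrow> card B = card S \<Longrightarrow> norm ((1 / real (card B)) *\<^sub>R (\<Sum>x\<in>B. x)) \<le> e"
    and S: "finite S" and r: "\<And>C. C \<in> S \<Longrightarrow> coset (null_along U) (r C) = C"
    "\<And>C n. C \<in> S \<Longrightarrow> apply_bcontfun (r C) n \<in> A"
  shows "vnorm (ultrapower U) (coset (null_along U) ((1 / real (card S)) *\<^sub>R (\<Sum>C\<in>S. r C))) \<le> e"
proof (rule tendsto_upperbound[OF ultrapower_norm_tendsto[OF U]])
  show "U \<noteq> bot" using U by (simp add: free_ultrafilter_def)
  have "eventually (\<lambda>n. apply_bcontfun (r C) n \<noteq> apply_bcontfun (r D) n) U"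
    if CD: "C \<in> S" "D \<in> S" "C \<noteq> D" for C D
  proof (rule ccontr)
    assume "\<not> ?thesis"
    then have "eventually (\<lambda>n. apply_bcontfun (r C) n = apply_bcontfun (r D) n) U"
      using U[unfolded free_ultrafilter_def, THEN conjunct2, THEN conjunct1, rule_format,
          of "\<lambda>n. apply_bcontfun (r C) n \<noteq> apply_bcontfun (r D) n"] by simp
    then have "eventually (\<lambda>n. apply_bcontfun (r C - r D) n = 0) U"
      by eventually_elim (simp add: minus_bcontfun.rep_eq)
    then have "r C - r D \<in> null_along U"
      unfolding null_along_iff by (rule tendsto_eventually)
    then have "coset (null_along U) (r C) = coset (null_along U) (r D)"
      by (rule coset_eqI[OF subspace_null_along])
    with CD show False by (simp add: r(1))
  qed
  \<comment> \<open>Finiteness of \<open>S\<close> allows one index set in \<open>U\<close> to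
    separate all pairs at once.\<close>
  then have "eventually (\<lambda>n. \<forall>C\<in>S. \<forall>D\<in>S. C \<noteq> D \<longrightarrow> apply_bcontfun (r C) n \<noteq> apply_bcontfun (r D) n) U"
    by (auto intro!: eventually_ball_finite S)
  then show "eventually (\<lambda>n. norm (apply_bcontfun ((1 / real (card S)) *\<^sub>R (\<Sum>C\<in>S. r C)) n) \<le> e) U"
  proof eventually_elim
    case (elim n)
    let ?h = "\<lambda>C. apply_bcontfun (r C) n"
    have inj: "inj_on ?h S" using elim by (auto simp: inj_on_def)
    have "apply_bcontfun (\<Sum>C\<in>T. r C) n = (\<Sum>C\<in>T. ?h C)" if "finite T" for T
      using that by (induction T) (auto simp: plus_bcontfun.rep_eq)
    then have avg_eq: "apply_bcontfun ((1 / real (card S)) *\<^sub>R (\<Sum>C\<in>S. r C)) n =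
        (1 / real (card (?h ` S))) *\<^sub>R (\<Sum>x\<in>?h ` S. x)"
      using S inj by (simp add: scaleR_bcontfun.rep_eq card_image sum.reindex)
    then show ?case
      unfolding avg_eq using S r(2) by (intro avg) (auto simp: card_image[OF inj])
  qed
qed

lemma sum_greater_mean:
  fixes g :: "'b \<Rightarrow> real"
  assumes "finite S" "S \<noteq> {}" "\<And>x. x \<in> S \<Longrightarrow> e < g x"
  shows "e < (1 / real (card S)) * (\<Sum>x\<in>S. g x)"
proof -
  have "real (card S) * e < (\<Sum>x\<in>S. g x)"
    using sum_strict_mono[OF assms(1,2), of "\<lambda>_. e" g] assms(3) by simp
  moreover have "card S > 0" using assms by (simp add: card_gt_0_iff)
  ultimately show ?thesis by (simp add: field_simps)
qed

text \<open>Among infinitely many points with large values, \<open>k\<close> could be chosen with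
  values of one sign. Then \<open>f\<close> would exceed \<open>e\<close> in absolute value at their
  average, whose norm is at most \<open>e\<close>.\<close>

lemma finite_ultrapower_large:
  fixes A :: "'a::real_normed_vector set"
  assumes U: "free_ultrafilter U" and k: "k \<ge> 1"
    and avg: "\<And>B. finite B \<Longrightarrow> B \<subseteq> A \<Longrightarrow> card B = k \<Longrightarrow> norm ((1 / real (card B)) *\<^sub>R (\<Sum>x\<in>B. x)) \<le> e"
    and f: "f \<in> unit_ball (dual (ultrapower U))"
  shows "finite {C \<in> ultrapower_set U A. \<bar>f C\<bar> > e}"
proof -
  let ?c = "coset (null_along U)"
  note lin = unit_ball_dual_ultrapower(1)[OF U f]
  \<comment> \<open>The sign \<open>s\<close> separates large positive from large negative values,
    which could cancel in an average.\<close>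
  have "finite {C \<in> ultrapower_set U A. s * f C > e}" if s: "\<bar>s\<bar> = 1" for s
  proof (rule ccontr)
    assume "infinite {C \<in> ultrapower_set U A. s * f C > e}"
    then obtain S where S: "finite S" "card S = k" "S \<subseteq> {C \<in> ultrapower_set U A. s * f C > e}"
      using infinite_arbitrarily_large[of _ k] by blast
    have "\<forall>C\<in>S. \<exists>x. ?c x = C \<and> (\<forall>n. apply_bcontfun x n \<in> A)"
      using S(3) by (auto elim!: ultrapower_setE)
    then obtain r where r: "\<And>C. C \<in> S \<Longrightarrow> ?c (r C) = C" "\<And>C n. C \<in> S \<Longrightarrow> apply_bcontfun (r C) n \<in> A"
      by metis
    let ?m = "(1 / real (card S)) *\<^sub>R (\<Sum>C\<in>S. r C)"
    have "S \<noteq> {}" using S k by auto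
    with S have "e < (1 / real (card S)) * (\<Sum>C\<in>S. s * f C)" by (intro sum_greater_mean) auto
    also have "\<dots> = s * ((1 / real (card S)) * (\<Sum>C\<in>S. f (?c (r C))))"
      by (simp add: r flip: sum_distrib_left)
    also have "(1 / real (card S)) * (\<Sum>C\<in>S. f (?c (r C))) = f (?c ?m)"
      using linear_scale[OF lin, of "1 / real (card S)" "\<Sum>C\<in>S. r C"] linear_sum[OF lin, of r S] by simp
    also have "s * f (?c ?m) \<le> \<bar>f (?c ?m)\<bar>"
      using s abs_ge_self[of "s * f (?c ?m)"] by (simp add: abs_mult)
    also have "\<dots> \<le> vnorm (ultrapower U) (?c ?m)"
      by (rule unit_ball_dual_ultrapower(2)[OF U f])
    also have "\<dots> \<le> e"
      using avg S(2) by (intro ultrapower_average_le[OF U _ S(1) r]) auto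
    finally show False by simp
  qed
  from this[of 1] this[of "-1"] have
    "finite ({C \<in> ultrapower_set U A. f C > e} \<union> {C \<in> ultrapower_set U A. - f C > e})" by simp
  then show ?thesis by (rule finite_subset[rotated]) auto
qed

lemma ultra_gamma_le:
  fixes A :: "'a::real_normed_vector set"
  assumes U: "free_ultrafilter U" and e: "e > 0" and k: "k \<ge> 1"
    and avg: "\<And>B. finite B \<Longrightarrow> B \<subseteq> A \<Longrightarrow> card B = k \<Longrightarrow> norm ((1 / real (card B)) *\<^sub>R (\<Sum>x\<in>B. x)) \<le> e"
  shows "ultra_gamma U A \<le> e"
  unfolding ultra_gamma_def
proof (rule gamma_le[OF e closed_operations_ultrapower])
  let ?o = "coset (null_along U) (0 :: nat \<Rightarrow>\<^sub>C 'a)"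
  show "?o \<in> vecs (ultrapower U)" by (simp add: vecs_ultrapower)
  show "vscale (ultrapower U) 0 ?o = ?o" by (simp add: ultrapower_ops)
  show "vnorm (ultrapower U) ?o = 0" using ultrapower_norm_scale[OF U, of 0 0] by simp
  show "ultrapower_set U A \<subseteq> vecs (ultrapower U)" by (auto simp: ultrapower_set_def)
qed (use finite_ultrapower_large[OF U k avg] in blast)

section \<open>Comparison of the two conditions on \<open>A\<close>\<close>

text \<open>The average of \<open>k\<close> points where \<open>s * f\<close> exceeds
  \<open>e\<close> would have norm above \<open>e\<close>. Each of the two signs thus accounts for
  at most \<open>k\<close> points, whence the factor 2.\<close>

lemma card_large_values_le:
  fixes A :: "'a::real_normed_vector set" and f :: "'a \<Rightarrow>\<^sub>L real"
  assumes k: "k \<ge> 1"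
    and avg: "\<And>B. finite B \<Longrightarrow> B \<subseteq> A \<Longrightarrow> card B = k \<Longrightarrow> norm ((1 / real (card B)) *\<^sub>R (\<Sum>x\<in>B. x)) \<le> e"
    and f: "norm f \<le> 1"
  shows "finite {x \<in> A. \<bar>blinfun_apply f x\<bar> > e} \<and> card {x \<in> A. \<bar>blinfun_apply f x\<bar> > e} \<le> 2 * k"
proof -
  have *: "finite {x \<in> A. s * blinfun_apply f x > e} \<and> card {x \<in> A. s * blinfun_apply f x > e} \<le> k"
    if s: "\<bar>s\<bar> = 1" for s
  proof (rule ccontr)
    let ?F = "{x \<in> A. s * blinfun_apply f x > e}"
    assume "\<not> (finite ?F \<and> card ?F \<le> k)"
    \<comment> \<open>Both an infinite set and a finite one with more than \<open>k\<close> elements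
      contain a subset of size \<open>k\<close>.\<close>
    then obtain S where S: "finite S" "card S = k" "S \<subseteq> ?F"
      using infinite_arbitrarily_large[of ?F k] obtain_subset_with_card_n[of k ?F]
      by (cases "finite ?F") auto
    let ?m = "(1 / real (card S)) *\<^sub>R (\<Sum>x\<in>S. x)"
    have "S \<noteq> {}" using S k by auto
    with S have "e < (1 / real (card S)) * (\<Sum>x\<in>S. s * f x)" by (intro sum_greater_mean) auto
    also have "\<dots> = s * f ?m"
      by (simp add: blinfun.scaleR_right blinfun.sum_right flip: sum_distrib_left)
    also have "\<dots> \<le> norm (f ?m)"
      using s abs_ge_self[of "s * f ?m"] by (simp add: abs_mult)
    also have "\<dots> \<le> norm f * norm ?m" by (rule norm_blinfun)
    also have "\<dots> \<le> norm ?m"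
      by (rule mult_left_le_one_le[OF norm_ge_zero norm_ge_zero f])
    also have "\<dots> \<le> e" using S by (intro avg) auto
    finally show False by simp
  qed
  have eq: "{x \<in> A. \<bar>blinfun_apply f x\<bar> > e} = {x \<in> A. 1 * f x > e} \<union> {x \<in> A. - 1 * f x > e}"
    by auto
  show ?thesis
    unfolding eq using *[of 1] *[of "-1"] card_Un_le[of "{x \<in> A. 1 * f x > e}" "{x \<in> A. - 1 * f x > e}"]
    by simp
qed

text \<open>Let \<open>f\<close> norm the average. All but at most \<open>k\<close> terms contribute
  at most \<open>e\<close>, the others at most \<open>M\<close>; the lower bound on
  \<open>card B\<close> makes the total excess \<open>k * M\<close> smaller than
  \<open>card B * d\<close>.\<close>

lemma norm_average_less:
  fixes A :: "'a::real_normed_vector set"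
  assumes M: "\<And>x. x \<in> A \<Longrightarrow> norm x \<le> M" and e: "e > 0" and d: "d > 0"
    and cd: "\<And>f :: 'a \<Rightarrow>\<^sub>L real. norm f \<le> 1 \<Longrightarrow>
      finite {x \<in> A. \<bar>blinfun_apply f x\<bar> > e} \<and> card {x \<in> A. \<bar>blinfun_apply f x\<bar> > e} \<le> k"
    and B: "finite B" "B \<subseteq> A" "real (card B) > real k * M / d" "B \<noteq> {}"
  shows "norm ((1 / real (card B)) *\<^sub>R (\<Sum>x\<in>B. x)) < e + d"
proof -
  let ?m = "(1 / real (card B)) *\<^sub>R (\<Sum>x\<in>B. x)"
  have M0: "M \<ge> 0" using B(2,4) M norm_ge_zero order_trans by (metis ex_in_conv subsetD)
  have n: "real (card B) > 0" using B by (simp add: card_gt_0_iff)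
  obtain f :: "'a \<Rightarrow>\<^sub>L real" where f: "norm f \<le> 1" "f ?m = norm ?m"
    using norming_functional by blast
  let ?F = "{x \<in> A. \<bar>blinfun_apply f x\<bar> > e}"
  \<comment> \<open>On the exceptional set the crude bound \<open>M\<close> is relaxed to
    \<open>e + M\<close>, so that the sum splits into a constant part and a count.\<close>
  have "f x \<le> e + (if x \<in> ?F then M else 0)" if x: "x \<in> B" for x
  proof -
    have "f x \<le> norm f * norm x" using norm_blinfun[of f x] by simp
    also have "\<dots> \<le> norm x" using f by (simp add: mult_left_le_one_le)
    also have "\<dots> \<le> M" using M x B by auto
    finally show ?thesis using x B e by auto
  qed
  then have "(\<Sum>x\<in>B. f x) \<le> (\<Sum>x\<in>B. e + (if x \<in> ?F then M else 0))" by (rule sum_mono)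
  also have "\<dots> = real (card B) * e + real (card (B \<inter> ?F)) * M"
    using B(1) by (simp add: sum.distrib sum.If_cases)
  also have "real (card (B \<inter> ?F)) * M \<le> real k * M"
    using cd[OF f(1)] card_mono[of ?F "B \<inter> ?F"] M0 by (intro mult_right_mono) auto
  also have "real k * M < real (card B) * d" using B(3) d by (simp add: field_simps)
  finally have "(\<Sum>x\<in>B. f x) < real (card B) * (e + d)" by (simp add: algebra_simps)
  moreover have "norm ?m = (1 / real (card B)) * (\<Sum>x\<in>B. f x)"
    unfolding f(2)[symmetric] by (simp add: blinfun.scaleR_right blinfun.sum_right)
  ultimately show ?thesis using n by (simp add: field_simps)
qed

theorem proposition1p3:
  fixes A :: "'a::banach set" and U :: "nat filter" and \<epsilon>1 \<epsilon>2 :: real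
  assumes "free_ultrafilter U"
    and "bounded A"
    and "\<epsilon>1 = Inf {\<epsilon>. \<epsilon> > 0 \<and> (\<exists>n1::nat. n1 \<ge> 1 \<and>
            (\<forall>f :: 'a \<Rightarrow>\<^sub>L real. norm f \<le> 1 \<longrightarrow>
               finite {x \<in> A. \<bar>blinfun_apply f x\<bar> > \<epsilon>} \<and>
               card {x \<in> A. \<bar>blinfun_apply f x\<bar> > \<epsilon>} \<le> n1))}"
    and "\<epsilon>2 = Inf {\<epsilon>. \<epsilon> > 0 \<and> (\<exists>n2::nat. n2 \<ge> 1 \<and>
            (\<forall>B. finite B \<and> B \<subseteq> A \<and> card B \<ge> n2 \<longrightarrow>
               norm ((1 / real (card B)) *\<^sub>R (\<Sum>x\<in>B. x)) < \<epsilon>))}"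
  shows "\<epsilon>1 = \<epsilon>2 \<and> ultra_gamma U A \<le> \<epsilon>1"
proof -
  let ?P1 = "\<lambda>e k. \<forall>f :: 'a \<Rightarrow>\<^sub>L real. norm f \<le> 1 \<longrightarrow>
    finite {x \<in> A. \<bar>blinfun_apply f x\<bar> > e} \<and> card {x \<in> A. \<bar>blinfun_apply f x\<bar> > e} \<le> k"
  let ?P2 = "\<lambda>e k. \<forall>B. finite B \<and> B \<subseteq> A \<and> card B \<ge> k \<longrightarrow>
    norm ((1 / real (card B)) *\<^sub>R (\<Sum>x\<in>B. x)) < e"
  define E1 where "E1 = {e. e > 0 \<and> (\<exists>k::nat. k \<ge> 1 \<and> ?P1 e k)}"
  define E2 where "E2 = {e. e > 0 \<and> (\<exists>k::nat. k \<ge> 1 \<and> ?P2 e k)}"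
  have eps: "\<epsilon>1 = Inf E1" "\<epsilon>2 = Inf E2" using assms(3,4) by (simp_all add: E1_def E2_def)
  obtain M where M: "M > 0" "\<And>x. x \<in> A \<Longrightarrow> norm x \<le> M"
    using assms(2) by (auto simp: bounded_pos)
  have bdd: "bdd_below E1" "bdd_below E2" by (auto simp: E1_def E2_def intro!: bdd_belowI[of _ 0])
  have "E2 \<subseteq> E1"
  proof
    fix e assume "e \<in> E2"
    then obtain k :: nat where e: "e > 0" "k \<ge> 1" and k: "?P2 e k" unfolding E2_def by blast
    have "?P1 e (2 * k)"
      using k by (intro allI impI card_large_values_le[OF e(2)]) (auto intro: less_imp_le)
    with e show "e \<in> E1" unfolding E1_def by (auto intro!: exI[of _ "2 * k"])
  qed
  \<comment> \<open>The reverse inclusion is obtained only up to an arbitrary \<open>d > 0\<close>,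
    which suffices for equality of the infima.\<close>
  have shift: "e + d \<in> E2" if e1: "e \<in> E1" and d: "d > 0" for e d
  proof -
    obtain k :: nat where e: "e > 0" and k: "?P1 e k" using e1 unfolding E1_def by blast
    obtain m :: nat where m: "real m > real k * M / d" using reals_Archimedean2 by blast
    \<comment> \<open>The successor makes the threshold at least 1, so that \<open>B\<close> is
      nonempty.\<close>
    have "?P2 (e + d) (Suc m)"
    proof (intro allI impI)
      fix B assume B: "finite B \<and> B \<subseteq> A \<and> card B \<ge> Suc m"
      then have "real (card B) > real k * M / d" "B \<noteq> {}" using m by (auto intro: less_le_trans)
      with B show "norm ((1 / real (card B)) *\<^sub>R (\<Sum>x\<in>B. x)) < e + d"
        using k by (intro norm_average_less[OF M(2) e d]) auto
    qed
    with e d show ?thesis unfolding E2_def by (auto intro!: exI[of _ "Suc m"])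
  qed
  have "\<bar>f x\<bar> \<le> M" if "norm f \<le> 1" "x \<in> A" for f :: "'a \<Rightarrow>\<^sub>L real" and x
    using norm_blinfun[of f x] mult_left_le_one_le[of "norm x" "norm f"] that M(2)[of x] by simp
  then have empty: "{x \<in> A. \<bar>blinfun_apply f x\<bar> > M} = {}" if "norm f \<le> 1" for f :: "'a \<Rightarrow>\<^sub>L real"
    using that by (auto simp: not_less)
  \<comment> \<open>No functional of norm at most 1 exceeds \<open>M\<close> on \<open>A\<close>, so
    any count works and 1 is the least one allowed. This makes \<open>E1\<close>, and through
    \<open>shift\<close> also \<open>E2\<close>, nonempty, as needed for the infima.\<close>
  have "?P1 M 1" by (intro allI impI) (simp only: empty, simp)
  then have "M \<in> E1" using M(1) unfolding E1_def by blast
  then have ne: "E1 \<noteq> {}" "E2 \<noteq> {}" using shift[of M 1] by auto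
  have "Inf E1 = Inf E2"
  proof (rule antisym)
    show "Inf E1 \<le> Inf E2" by (rule cInf_superset_mono[OF ne(2) bdd(1) \<open>E2 \<subseteq> E1\<close>])
    show "Inf E2 \<le> Inf E1"
    proof (rule cInf_greatest[OF ne(1)])
      fix e assume "e \<in> E1"
      then show "Inf E2 \<le> e"
        by (blast intro: field_le_epsilon cInf_lower[OF _ bdd(2)] shift)
    qed
  qed
  moreover have "ultra_gamma U A \<le> Inf E2"
  proof (rule cInf_greatest[OF ne(2)])
    fix e assume "e \<in> E2"
    then obtain k :: nat where e: "e > 0" "k \<ge> 1" and k: "?P2 e k" unfolding E2_def by blast
    show "ultra_gamma U A \<le> e"
      using k by (intro ultra_gamma_le[OF assms(1) e]) (auto intro: less_imp_le)
  qed
  ultimately show ?thesis using eps by simp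
qed

end
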